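(* Let $n\ge 3$ and let $Q\in\mathbf S(s_1,\dots,s_n)$ be tangential, with inscribed circle $\sigma(Q)$ of signed radius $r$ and center $O$. If $r>0$, then $Q$ is a nondegenerate (Morse) critical point of $\mathcal P|_{\mathbf S}$ and its Morse index is $$\mu_Q(\mathcal P)=RT-1+2\omega_Q-\begin{cases}1,&\mathcal P(Q)>0,\\0,&\text{otherwise}.\end{cases}$$ If $r<0$, then $$\mu_Q(\mathcal P)=n-3-\mu_{-Q}(\mathcal P)=LT-1-2\omega_Q-\begin{cases}1,&\mathcal P(Q)>0,\\0,&\text{otherwise}.\end{cases}$$
   Context: Fix $n\ge 3$ pairwise non-parallel lines $s_1,\dots,s_n\subset\mathbb{R}^2$ through the origin, each with a fixed direction $\vec s_i$. For lines $e_i\parallel s_i$, $Q=Q(e_1,\dots,e_n)$ is the closed polygon with consecutive vertices $v_i=e_i\cap e_{i+1}$ (indices mod $n$), and $\widetilde{\mathbf S}(s_1,\dots,s_n)$ is the space of such polygons modulo translations. Oriented area: $\mathcal A=\frac12\sum_i(x_iy_{i+1}-x_{i+1}y_i)$ for $v_i=(x_i,y_i)$; $\mathbf S=\{Q\in\widetilde{\mathbf S}:|\mathcal A(Q)|=1\}$. Each $e_i$ is oriented along $\vec s_i$, giving $\vec e_i$; the perimeter is $\mathcal P(Q)=\sum_i\operatorname{sign}_Q(i)|v_iv_{i+1}|$ with $\operatorname{sign}_Q(i)=1$ if $\vec e_i$ is codirected with $\overrightarrow{v_iv_{i+1}}$ and $-1$ otherwise. $Q$ is tangential if there is a circle $\sigma$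 tangent to every $e_i$ lying either to the left of all $\vec e_i$ or to the right of all $\vec e_i$; its signed radius is its radius with sign $+$ if it lies to the left and $-$ otherwise. $-Q=Q(-e_1,\dots,-e_n)$ (point reflection). $\omega_Q$ is the winding number of the closed broken line $v_1v_2\dots v_n$ around $O$. For an ordered pair of directed slopes $(\vec s_i,\vec s_j)$ we have a right turn (resp. left turn) if $\vec s_j$ is obtained from $\vec s_i$ by a clockwise (resp. counterclockwise) rotation by an angle smaller than $\pi$. $RT$ (resp. $LT$) is the number of right (resp. left) turns among the pairs $(\vec s_1,\vec s_2),(\vec s_2,\vec s_3),\dots,(\vec s_n,\vec s_1)$. $\mu_Q(\mathcal P)$ is the number of negative eigenvalues of the Hessian of $\mathcal P|_{\mathbf S}$ at $Q$. *)

theory Defs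
  imports "HOL-Analysis.Analysis"
begin

definition cross :: "complex \<Rightarrow> complex \<Rightarrow> real" where
  "cross a b = Im (cnj a * b)"

text \<open>The line e_i parallel to the direction d i, given by its offset h i:
  e_i = {p. cross (d i) p = h i}.  Indices are taken modulo n by the callers.\<close>
definition eline :: "(nat \<Rightarrow> complex) \<Rightarrow> (nat \<Rightarrow> real) \<Rightarrow> nat \<Rightarrow> complex set" where
  "eline d h i = {p. cross (d i) p = h i}"

definition vert :: "nat \<Rightarrow> (nat \<Rightarrow> complex) \<Rightarrow> (nat \<Rightarrow> real) \<Rightarrow> nat \<Rightarrow> complex" where
  "vert n d h i = (THE p. p \<in> eline d h (i mod n) \<inter> eline d h (Suc i mod n))"

definition area :: "nat \<Rightarrow> (nat \<Rightarrow> complex) \<Rightarrow> (nat \<Rightarrow> real) \<Rightarrow> real" where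
  "area n d h = (1/2) * (\<Sum>i<n. Re (vert n d h i) * Im (vert n d h (Suc i))
                              - Re (vert n d h (Suc i)) * Im (vert n d h i))"

text \<open>Signed perimeter.  The side v_i v_(i+1) lies on the line e_(i+1); its sign is +1
  iff the vector from v_i to v_(i+1) is codirected with the orientation of that line.\<close>
definition perim :: "nat \<Rightarrow> (nat \<Rightarrow> complex) \<Rightarrow> (nat \<Rightarrow> real) \<Rightarrow> real" where
  "perim n d h = (\<Sum>i<n.
     (if (\<exists>t::real\<ge>0. vert n d h (Suc i) - vert n d h i = of_real t * d (Suc i mod n)) then 1 else -1)
       * cmod (vert n d h (Suc i) - vert n d h i))"

text \<open>Inscribed circle with center X and signed radius r: the circle of radius |r|
  around X is tangent to every e_i, and lies to the left of all directed lines if r > 0,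
  to the right of all of them if r < 0.\<close>
definition is_incircle :: "nat \<Rightarrow> (nat \<Rightarrow> complex) \<Rightarrow> (nat \<Rightarrow> real) \<Rightarrow> complex \<Rightarrow> real \<Rightarrow> bool" where
  "is_incircle n d h X r \<longleftrightarrow> r \<noteq> 0 \<and>
     (\<forall>i<n. infdist X (eline d h i) = \<bar>r\<bar>) \<and>
     (r > 0 \<longrightarrow> (\<forall>i<n. cross (d i) X > h i)) \<and>
     (r < 0 \<longrightarrow> (\<forall>i<n. cross (d i) X < h i))"

definition winding_poly :: "nat \<Rightarrow> (nat \<Rightarrow> complex) \<Rightarrow> (nat \<Rightarrow> real) \<Rightarrow> complex \<Rightarrow> real" where
  "winding_poly n d h X =
     (\<Sum>i<n. Arg ((vert n d h (Suc i) - X) / (vert n d h i - X))) / (2 * pi)"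

definition RT :: "nat \<Rightarrow> (nat \<Rightarrow> complex) \<Rightarrow> nat" where
  "RT n d = card {i. i < n \<and> cross (d i) (d (Suc i mod n)) < 0}"

definition LT :: "nat \<Rightarrow> (nat \<Rightarrow> complex) \<Rightarrow> nat" where
  "LT n d = card {i. i < n \<and> cross (d i) (d (Suc i mod n)) > 0}"

text \<open>A polygon is determined by the offsets of its lines; we use the vector
  x :: real^'n of offsets, where the coordinate ix i (i < n = CARD('n)) is the offset
  of the line e_i.  Translations are factored out by the global section
  "v_0 = 0", i.e. x $ ix 0 = 0 and x $ ix 1 = 0 (every polygon has exactly one such
  translate since s_0, s_1 are not parallel).\<close>
definition offs :: "(nat \<Rightarrow> 'n::finite) \<Rightarrow> real^'n \<Rightarrow> nat \<Rightarrow> real" where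
  "offs ix x i = x $ ix (i mod CARD('n))"

definition polyS :: "(nat \<Rightarrow> complex) \<Rightarrow> (nat \<Rightarrow> 'n::finite) \<Rightarrow> (real^'n) set" where
  "polyS d ix = {x. x $ ix 0 = 0 \<and> x $ ix 1 = 0 \<and> \<bar>area CARD('n) d (offs ix x)\<bar> = 1}"

definition perimF :: "(nat \<Rightarrow> complex) \<Rightarrow> (nat \<Rightarrow> 'n::finite) \<Rightarrow> real^'n \<Rightarrow> real" where
  "perimF d ix x = perim CARD('n) d (offs ix x)"

definition C2_curve_at :: "'a::real_normed_vector set \<Rightarrow> 'a \<Rightarrow> (real \<Rightarrow> 'a) \<Rightarrow> bool" where
  "C2_curve_at M x \<gamma> \<longleftrightarrow> \<gamma> 0 = x \<and>
     (\<exists>\<epsilon>>0. (\<forall>t\<in>{-\<epsilon><..<\<epsilon>}. \<gamma> t \<in> M) \<and>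
        (\<exists>\<gamma>1 \<gamma>2. (\<forall>t\<in>{-\<epsilon><..<\<epsilon>}. (\<gamma> has_vector_derivative \<gamma>1 t) (at t) \<and>
                                   (\<gamma>1 has_vector_derivative \<gamma>2 t) (at t)) \<and>
                 continuous_on {-\<epsilon><..<\<epsilon>} \<gamma>2))"

definition tangent_space :: "'a::real_normed_vector set \<Rightarrow> 'a \<Rightarrow> 'a set" where
  "tangent_space M x = {vector_derivative \<gamma> (at 0) | \<gamma>. C2_curve_at M x \<gamma>}"

definition critical_point :: "('a::real_normed_vector \<Rightarrow> real) \<Rightarrow> 'a set \<Rightarrow> 'a \<Rightarrow> bool" where
  "critical_point f M x \<longleftrightarrow> x \<in> M \<and> (\<forall>\<gamma>. C2_curve_at M x \<gamma> \<longrightarrow> deriv (f \<circ> \<gamma>) 0 = 0)"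

definition hessian_form :: "('a::real_normed_vector \<Rightarrow> real) \<Rightarrow> 'a set \<Rightarrow> 'a \<Rightarrow> 'a \<Rightarrow> real" where
  "hessian_form f M x v = (THE q. \<forall>\<gamma>. C2_curve_at M x \<gamma> \<and> vector_derivative \<gamma> (at 0) = v
                                     \<longrightarrow> deriv (deriv (f \<circ> \<gamma>)) 0 = q)"

definition nondeg_critical_point :: "('a::real_normed_vector \<Rightarrow> real) \<Rightarrow> 'a set \<Rightarrow> 'a \<Rightarrow> bool" where
  "nondeg_critical_point f M x \<longleftrightarrow> critical_point f M x \<and>
     (\<forall>u\<in>tangent_space M x.
        (\<forall>w\<in>tangent_space M x. hessian_form f M x (u + w) - hessian_form f M x u
                                  - hessian_form f M x w = 0) \<longrightarrow> u = 0)"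

text \<open>Morse index = number of negative eigenvalues of the Hessian (counted with
  multiplicity) = maximal dimension of a subspace of the tangent space on which the
  Hessian is negative definite (Sylvester).\<close>
definition morse_index :: "('a::euclidean_space \<Rightarrow> real) \<Rightarrow> 'a set \<Rightarrow> 'a \<Rightarrow> nat" where
  "morse_index f M x = Max {dim V | V. subspace V \<and> V \<subseteq> tangent_space M x \<and>
                              (\<forall>v\<in>V. v \<noteq> 0 \<longrightarrow> hessian_form f M x v < 0)}"

end

theory Submission
  imports Defs
begin

text \<open>
  The area is a quadratic form in the offsets \<open>h\<close>. Adding the lines one at a time cuts the
  polygon into the triangles bounded by the lines \<open>e_(m-1)\<close>, \<open>e_m\<close>, \<open>e_0\<close>, which
  diagonalises the form as \<open>\<Sum>m=2..<n. C_m (L_m h)\<^sup>2\<close>. The perimeter is a mixed area: if the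
  polygon \<open>Q\<close> has an inscribed circle of signed radius \<open>r\<close>, its offsets are
  \<open>- r \<bar>d_i\<bar>\<close> up to a translation, and the perimeter equals \<open>B(Q, _)\<close>, where \<open>B\<close> is
  \<open>2/r\<close> times the polarised area. Hence \<open>Q\<close> is critical, the tangent space is the
  \<open>B\<close>-orthogonal complement of \<open>Q\<close>, and the Hessian is \<open>- B\<close> on it, so the Morse index is the
  number of \<open>m\<close> with \<open>r C_m > 0\<close>, minus 1 if \<open>B(Q, Q) = P(Q)\<close> is positive.

  The signs of the \<open>C_m\<close> are counted by adding the lines one at a time again. The number of right
  turns plus the turning angle over \<open>\<pi>\<close> is the angle between undirected lines, as a fraction of
  \<open>\<pi>\<close>. It is additive up to integers, and the defect is one at the triangles with
  \<open>C_m > 0\<close> and zero at the others. Finally, the turning angles of the directions add up to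
  \<open>2 \<pi>\<close> times the winding number.
\<close>

section \<open>Positive index of a symmetric bilinear form\<close>

definition pos_def_on :: "('a::real_vector \<Rightarrow> 'a \<Rightarrow> real) \<Rightarrow> 'a set \<Rightarrow> bool" where
  "pos_def_on B V \<longleftrightarrow> (\<forall>v\<in>V. v \<noteq> 0 \<longrightarrow> 0 < B v v)"

definition pos_index :: "('a::euclidean_space \<Rightarrow> 'a \<Rightarrow> real) \<Rightarrow> 'a set \<Rightarrow> nat" where
  "pos_index B W = Max {dim V |V. subspace V \<and> V \<subseteq> W \<and> pos_def_on B V}"

lemma finite_dims: "finite {dim V |V :: 'a::euclidean_space set. P V}"
  by (rule finite_subset[of _ "{..DIM('a)}"]) (auto intro: dim_subset_UNIV)

lemma dim_le_pos_index:
  assumes "subspace V" "V \<subseteq> W" "pos_def_on B V"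
  shows "dim V \<le> pos_index B W"
  unfolding pos_index_def using assms by (intro Max_ge finite_dims) blast

lemma pos_index_attained:
  assumes "subspace W"
  obtains V where "subspace V" "V \<subseteq> W" "pos_def_on B V" "dim V = pos_index B W"
proof -
  let ?dims = "{dim V |V. subspace V \<and> V \<subseteq> W \<and> pos_def_on B V}"
  have "subspace {0 :: 'a} \<and> {0} \<subseteq> W \<and> pos_def_on B {0}"
    using subspace_0[OF assms] by (simp add: pos_def_on_def)
  then have "?dims \<noteq> {}" by blast
  then have "Max ?dims \<in> ?dims" by (rule Max_in[OF finite_dims])
  then show ?thesis using that unfolding pos_index_def by force
qed

lemma dim_add_dim_le:
  fixes U V W :: "'a::euclidean_space set"
  assumes "subspace U" "subspace V" "subspace W" "U \<subseteq> W" "V \<subseteq> W" "U \<inter> V \<subseteq> {0}"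
  shows "dim U + dim V \<le> dim W"
proof -
  have "dim U + dim V = dim {u + v |u v. u \<in> U \<and> v \<in> V}"
    using dim_sums_Int[OF assms(1,2)] assms(6) by (simp flip: dim_eq_0)
  also have "\<dots> \<le> dim W"
    using assms by (intro dim_subset) (auto intro: subspace_add)
  finally show ?thesis .
qed

locale quadratic_space = bounded_bilinear B
  for B :: "'a::euclidean_space \<Rightarrow> 'a \<Rightarrow> real" +
  fixes W :: "'a set"
  assumes commute: "B u v = B v u"
    and subspace_W: "subspace W"
begin

definition orth :: "'a \<Rightarrow> 'a set" where "orth x = {v \<in> W. B x v = 0}"

lemma orth_subset: "orth x \<subseteq> W"
  by (auto simp: orth_def)

lemma subspace_orth: "subspace (orth x)"
  using subspace_W unfolding subspace_def orth_def
  by (auto simp: zero_right add_right scaleR_right)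

lemma orth_projection:
  assumes "p \<in> W" "w \<in> W" "B x p \<noteq> 0"
  shows "w - (B x w / B x p) *\<^sub>R p \<in> orth x"
  using assms subspace_W
  by (auto simp: orth_def diff_right scaleR_right intro!: subspace_diff subspace_scale)

lemma B_orth_add_scaleR:
  assumes "v \<in> orth x"
  shows "B (c *\<^sub>R x + a *\<^sub>R v) (c *\<^sub>R x + a *\<^sub>R v) = c\<^sup>2 * B x x + a\<^sup>2 * B v v"
  using assms commute[of v x]
  by (simp add: orth_def add_left add_right scaleR_left scaleR_right power2_eq_square)

lemma pos_def_on_span_insert:
  assumes "0 < B x x" "subspace V" "V \<subseteq> orth x" "pos_def_on B V"
  shows "pos_def_on B (span (insert x V))"
  unfolding pos_def_on_def
proof safe
  fix u assume "u \<in> span (insert x V)" "u \<noteq> 0"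
  then obtain c where "u - c *\<^sub>R x \<in> V"
    using assms(2) by (auto simp: span_breakdown_eq span_eq_iff[THEN iffD2])
  then obtain v where "v \<in> V" and u_eq: "u = c *\<^sub>R x + 1 *\<^sub>R v"
    by (metis add.commute diff_add_cancel scaleR_one)
  then have "B u u = c\<^sup>2 * B x x + B v v"
    using B_orth_add_scaleR[of v x c 1] assms(3) by auto
  moreover have "0 < B v v \<or> v = 0 \<and> c \<noteq> 0"
    using \<open>v \<in> V\<close> assms(4) u_eq \<open>u \<noteq> 0\<close> by (auto simp: pos_def_on_def)
  ultimately show "0 < B u u"
    using assms(1) by (auto simp: zero_left add_nonneg_pos)
qed

lemma pos_index_orth_less:
  assumes "x \<in> W" "0 < B x x"
  shows "pos_index B (orth x) < pos_index B W"
proof -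
  obtain V where V: "subspace V" "V \<subseteq> orth x" "pos_def_on B V"
    and dim_V: "dim V = pos_index B (orth x)"
    using pos_index_attained[OF subspace_orth] by blast
  have "x \<notin> V" using assms(2) V(2) by (auto simp: orth_def)
  then have "dim (span (insert x V)) = dim V + 1"
    using V(1) by (simp add: dim_insert span_eq_iff[THEN iffD2])
  moreover have "span (insert x V) \<subseteq> W"
    using assms(1) V(2) orth_subset subspace_W by (intro span_minimal) auto
  then have "dim (span (insert x V)) \<le> pos_index B W"
    using V assms(2) by (intro dim_le_pos_index pos_def_on_span_insert) auto
  ultimately show ?thesis using dim_V by simp
qed

lemma dim_le_dim_orth_Int:
  assumes "subspace P" "P \<subseteq> W"
  shows "dim P \<le> dim (P \<inter> orth x) + 1"
proof (cases "P \<subseteq> orth x")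
  case True
  then show ?thesis by (simp add: inf.absorb1)
next
  case False
  then obtain p where p: "p \<in> P" "B x p \<noteq> 0" using assms(2) by (auto simp: orth_def)
  have "P \<subseteq> span (insert p (P \<inter> orth x))"
  proof
    fix w assume "w \<in> P"
    then have "w - (B x w / B x p) *\<^sub>R p \<in> P \<inter> orth x"
      using p assms by (auto intro!: subspace_diff subspace_scale orth_projection)
    then show "w \<in> span (insert p (P \<inter> orth x))"
      unfolding span_breakdown_eq by (auto intro: span_base)
  qed
  then have "dim P \<le> dim (insert p (P \<inter> orth x))" by (metis dim_span dim_subset)
  then show ?thesis by (simp add: dim_insert split: if_splits)
qed

lemma pos_index_le_pos_index_orth:
  assumes "x \<in> W" "B x x < 0"
  shows "pos_index B W \<le> pos_index B (orth x)"
proof -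
  obtain P where P: "subspace P" "P \<subseteq> W" and pos_P: "pos_def_on B P"
    and dim_P: "dim P = pos_index B W"
    using pos_index_attained[OF subspace_W] by blast
  define proj where "proj w = w - (B x w / B x x) *\<^sub>R x" for w
  have linear: "linear proj"
    unfolding proj_def linear_iff
    by (auto simp: add_right scaleR_right add_divide_distrib algebra_simps)
  have proj_orth: "proj w \<in> orth x" if "w \<in> P" for w
    using that P(2) assms by (auto simp: proj_def intro!: orth_projection)
  have pos_proj: "0 < B (proj w) (proj w)" if "w \<in> P" "w \<noteq> 0" for w
  proof -
    have "B w w = (B x w / B x x)\<^sup>2 * B x x + B (proj w) (proj w)"
      using B_orth_add_scaleR[OF proj_orth[OF that(1)], of "B x w / B x x" 1]
      by (simp add: proj_def)
    moreover have "(B x w / B x x)\<^sup>2 * B x x \<le> 0" using assms(2) by (simp add: mult_nonneg_nonpos)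
    moreover have "0 < B w w" using that pos_P by (simp add: pos_def_on_def)
    ultimately show ?thesis by linarith
  qed
  have "w = 0" if "w \<in> P" "proj w = 0" for w using pos_proj[of w] that by (auto simp: zero_left)
  then have "inj_on proj P" using linear_inj_on_iff_eq_0[OF linear P(1)] by blast
  then have "dim (proj ` P) = dim P"
    using dim_image_eq[OF linear, of P] P(1) by (simp add: span_eq_iff[THEN iffD2])
  moreover have "pos_def_on B (proj ` P)"
    using pos_proj linear_0[OF linear] by (auto simp: pos_def_on_def)
  then have "dim (proj ` P) \<le> pos_index B (orth x)"
    using proj_orth linear_subspace_image[OF linear P(1)] by (intro dim_le_pos_index) auto
  ultimately show ?thesis using dim_P by simp
qed

theorem pos_index_orth:
  assumes "x \<in> W" "B x x \<noteq> 0"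
  shows "pos_index B (orth x) + of_bool (0 < B x x) = pos_index B W"
proof -
  obtain P where P: "subspace P" "P \<subseteq> W" "pos_def_on B P" and dim_P: "dim P = pos_index B W"
    using pos_index_attained[OF subspace_W] by blast
  have "dim (P \<inter> orth x) \<le> pos_index B (orth x)"
    using P subspace_orth by (intro dim_le_pos_index subspace_inter) (auto simp: pos_def_on_def)
  then have "pos_index B W \<le> pos_index B (orth x) + 1"
    using dim_le_dim_orth_Int[OF P(1,2), of x] dim_P by linarith
  moreover obtain V where "subspace V" "V \<subseteq> orth x" "pos_def_on B V" "dim V = pos_index B (orth x)"
    using pos_index_attained[OF subspace_orth] by blast
  then have "pos_index B (orth x) \<le> pos_index B W"
    using dim_le_pos_index[of V W B] orth_subset by auto
  ultimately show ?thesis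
    using pos_index_orth_less pos_index_le_pos_index_orth assms by (cases "0 < B x x") force+
qed

definition nondegenerate :: bool where
  "nondegenerate \<longleftrightarrow> (\<forall>u\<in>W. (\<forall>w\<in>W. B u w = 0) \<longrightarrow> u = 0)"

lemma nondegenerate_on_orth:
  assumes "nondegenerate" "x \<in> W" "B x x \<noteq> 0" "u \<in> orth x"
    and annihilates: "\<And>w. w \<in> orth x \<Longrightarrow> B u w = 0"
  shows "u = 0"
proof -
  have "B u w = 0" if "w \<in> W" for w
    using annihilates[OF orth_projection[OF assms(2) that assms(3)]] assms(4) commute[of u x]
    by (simp add: orth_def diff_right scaleR_right)
  then show ?thesis using assms(1,4) by (auto simp: nondegenerate_def orth_def)
qed

end

locale orthogonal_basis = quadratic_space +
  fixes S :: "'a set"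
  assumes finite_S: "finite S"
    and span_S: "span S = W"
    and orthogonal_S: "u \<in> S \<Longrightarrow> v \<in> S \<Longrightarrow> u \<noteq> v \<Longrightarrow> B u v = 0"
    and nonisotropic_S: "u \<in> S \<Longrightarrow> B u u \<noteq> 0"
begin

lemma B_sum_basis:
  assumes "T \<subseteq> S" "u \<in> T"
  shows "B (\<Sum>v\<in>T. c v *\<^sub>R v) u = c u * B u u"
proof -
  have "B (\<Sum>v\<in>T. c v *\<^sub>R v) u = (\<Sum>v\<in>T. if v = u then c u * B u u else 0)"
    unfolding sum_left using assms orthogonal_S by (intro sum.cong) (auto simp: scaleR_left)
  then show ?thesis using assms finite_subset[OF assms(1) finite_S] by simp
qed

lemma independent_S: "independent S"
proof (rule independent_if_scalars_zero[OF finite_S])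
  fix c u assume "(\<Sum>v\<in>S. c v *\<^sub>R v) = 0" "u \<in> S"
  then show "c u = 0" using B_sum_basis[of S u c] nonisotropic_S by (simp add: zero_left)
qed

lemma dim_span_basis: "T \<subseteq> S \<Longrightarrow> dim (span T) = card T"
  using dim_span_eq_card_independent independent_mono[OF independent_S] by blast

lemma nondegenerate: nondegenerate
  unfolding nondegenerate_def
proof safe
  fix u assume "u \<in> W" and annihilates: "\<forall>w\<in>W. B u w = 0"
  then obtain c where u_eq: "u = (\<Sum>v\<in>S. c v *\<^sub>R v)"
    using span_S span_finite[OF finite_S] by auto
  have "c v = 0" if "v \<in> S" for v
    using B_sum_basis[OF order_refl that, of c] annihilates nonisotropic_S[OF that]
      span_base[OF that]
    by (simp add: span_S flip: u_eq)
  then show "u = 0" using u_eq by simp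
qed

lemma B_span_basis:
  assumes "T \<subseteq> S" "w \<in> span T"
  obtains c where "w = (\<Sum>v\<in>T. c v *\<^sub>R v)" "B w w = (\<Sum>v\<in>T. (c v)\<^sup>2 * B v v)"
proof -
  obtain c where w_eq: "w = (\<Sum>v\<in>T. c v *\<^sub>R v)"
    using assms span_finite[OF finite_subset[OF assms(1) finite_S]] by auto
  have "B w w = (\<Sum>v\<in>T. c v * B w v)"
    by (subst (2) w_eq) (simp add: sum_right scaleR_right)
  also have "\<dots> = (\<Sum>v\<in>T. (c v)\<^sup>2 * B v v)"
    using B_sum_basis[OF assms(1), of _ c]
    by (intro sum.cong) (simp_all add: w_eq power2_eq_square)
  finally show ?thesis using that w_eq by blast
qed

lemma pos_def_on_span_pos: "pos_def_on B (span {u \<in> S. 0 < B u u})"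
  unfolding pos_def_on_def
proof safe
  let ?P = "{u \<in> S. 0 < B u u}"
  fix w assume "w \<in> span ?P" "w \<noteq> 0"
  then obtain c where w_eq: "w = (\<Sum>v\<in>?P. c v *\<^sub>R v)" and B_w: "B w w = (\<Sum>v\<in>?P. (c v)\<^sup>2 * B v v)"
    using B_span_basis[of ?P w] by auto
  obtain v where "v \<in> ?P" "c v \<noteq> 0"
    using w_eq \<open>w \<noteq> 0\<close> by (metis (no_types, lifting) scale_eq_0_iff sum.neutral)
  then show "0 < B w w"
    unfolding B_w using finite_S by (intro sum_pos2[of _ v]) auto
qed

lemma nonpos_on_span_neg:
  assumes "w \<in> span {u \<in> S. B u u < 0}"
  shows "B w w \<le> 0"
proof -
  obtain c where "B w w = (\<Sum>v | v \<in> S \<and> B v v < 0. (c v)\<^sup>2 * B v v)"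
    using B_span_basis[OF _ assms] by auto
  then show ?thesis by (auto simp: mult_nonneg_nonpos intro!: sum_nonpos)
qed

lemma card_pos_add_card_neg: "card {u \<in> S. 0 < B u u} + card {u \<in> S. B u u < 0} = card S"
proof -
  have "card ({u \<in> S. 0 < B u u} \<union> {u \<in> S. B u u < 0})
      = card {u \<in> S. 0 < B u u} + card {u \<in> S. B u u < 0}"
    using finite_S by (intro card_Un_disjoint) auto
  moreover have "{u \<in> S. 0 < B u u} \<union> {u \<in> S. B u u < 0} = S"
    using nonisotropic_S by (auto simp: linorder_neq_iff)
  ultimately show ?thesis by simp
qed

theorem pos_index_eq_card_pos: "pos_index B W = card {u \<in> S. 0 < B u u}"
proof (rule antisym)
  let ?P = "{u \<in> S. 0 < B u u}" and ?N = "{u \<in> S. B u u < 0}"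
  have span_subset: "span T \<subseteq> W" if "T \<subseteq> S" for T using span_mono[OF that] span_S by simp
  show "card ?P \<le> pos_index B W"
    using dim_le_pos_index[OF subspace_span span_subset pos_def_on_span_pos] dim_span_basis[of ?P]
    by auto
  obtain V where V: "subspace V" "V \<subseteq> W" and pos_V: "pos_def_on B V"
    and dim_V: "dim V = pos_index B W"
    using pos_index_attained[OF subspace_W] by blast
  have "V \<inter> span ?N \<subseteq> {0}"
    using pos_V nonpos_on_span_neg by (force simp: pos_def_on_def)
  then have "dim V + dim (span ?N) \<le> dim W"
    using V subspace_W by (intro dim_add_dim_le span_subset) auto
  moreover have "dim (span ?N) = card ?N" "dim W = card S"
    using dim_span_basis[of ?N] dim_span_basis[of S] by (auto simp: span_S)
  ultimately show "pos_index B W \<le> card ?P"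
    using dim_V card_pos_add_card_neg by linarith
qed

end

section \<open>Level sets of quadratic forms\<close>

lemma C2_curve_atE:
  assumes "C2_curve_at M x \<gamma>"
  obtains U \<gamma>' \<gamma>'' where "open U" "0 \<in> U" "\<gamma> 0 = x" "\<And>t. t \<in> U \<Longrightarrow> \<gamma> t \<in> M"
    "\<And>t. t \<in> U \<Longrightarrow> (\<gamma> has_vector_derivative \<gamma>' t) (at t)"
    "\<And>t. t \<in> U \<Longrightarrow> (\<gamma>' has_vector_derivative \<gamma>'' t) (at t)"
proof -
  obtain \<epsilon> \<gamma>' \<gamma>'' where "\<epsilon> > 0" "\<gamma> 0 = x" "\<forall>t\<in>{-\<epsilon><..<\<epsilon>}. \<gamma> t \<in> M"
    "\<forall>t\<in>{-\<epsilon><..<\<epsilon>}. (\<gamma> has_vector_derivative \<gamma>' t) (at t) \<and>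
       (\<gamma>' has_vector_derivative \<gamma>'' t) (at t)"
    using assms unfolding C2_curve_at_def by blast
  then show ?thesis by (intro that[of "{-\<epsilon><..<\<epsilon>}" \<gamma>' \<gamma>'']) auto
qed

lemma C2_curve_atI:
  assumes "open U" "0 \<in> U" "\<gamma> 0 = x" "\<And>t. t \<in> U \<Longrightarrow> \<gamma> t \<in> M"
    and "\<And>t. t \<in> U \<Longrightarrow> (\<gamma> has_vector_derivative \<gamma>' t) (at t)"
    and "\<And>t. t \<in> U \<Longrightarrow> (\<gamma>' has_vector_derivative \<gamma>'' t) (at t)"
    and "continuous_on U \<gamma>''"
  shows "C2_curve_at M x \<gamma>"
proof -
  obtain \<epsilon> where "\<epsilon> > 0" "ball 0 \<epsilon> \<subseteq> U" using assms(1,2) open_contains_ball by blast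
  moreover have "ball 0 \<epsilon> = {-\<epsilon><..<\<epsilon>}" by (simp add: ball_eq_greaterThanLessThan)
  ultimately show ?thesis
    unfolding C2_curve_at_def using assms(3-6) continuous_on_subset[OF assms(7)]
    by (intro conjI exI[of _ \<epsilon>] exI[of _ \<gamma>'] exI[of _ \<gamma>'']) auto
qed

lemma has_real_derivative_locally_constant:
  fixes f :: "real \<Rightarrow> real"
  assumes "open U" "t \<in> U" "\<And>s. s \<in> U \<Longrightarrow> f s = c" "(f has_real_derivative D) (at t)"
  shows "D = 0"
proof -
  have "((\<lambda>_. c) has_real_derivative D) (at t)"
    by (rule has_field_derivative_transform_within_open[OF assms(4,1,2,3)])
  then show ?thesis using DERIV_unique DERIV_const by blast
qed

lemma has_vector_derivative_in_subspace:
  fixes \<gamma> :: "real \<Rightarrow> 'a::euclidean_space"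
  assumes "subspace W" "open U" "t \<in> U" "\<And>s. s \<in> U \<Longrightarrow> \<gamma> s \<in> W"
    and deriv: "(\<gamma> has_vector_derivative v) (at t)"
  shows "v \<in> W"
proof -
  have "z \<bullet> v = 0" if "z \<in> W\<^sup>\<bottom>" for z
  proof (rule has_real_derivative_locally_constant[OF assms(2,3)])
    show "z \<bullet> \<gamma> s = 0" if "s \<in> U" for s
      using \<open>z \<in> W\<^sup>\<bottom>\<close> assms(4)[OF that]
      by (auto simp: orthogonal_comp_def orthogonal_def inner_commute)
    show "((\<lambda>s. z \<bullet> \<gamma> s) has_real_derivative z \<bullet> v) (at t)"
      using bounded_linear.has_vector_derivative[OF bounded_linear_inner_right deriv]
      by (simp add: has_real_derivative_iff_has_vector_derivative)
  qed
  then have "v \<in> (W\<^sup>\<bottom>)\<^sup>\<bottom>" by (simp add: orthogonal_comp_def orthogonal_def)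
  then show ?thesis using orthogonal_comp_self[OF assms(1)] by simp
qed

text \<open>The rational parametrisation \<open>((1 - k t\<^sup>2) x + t v) / (1 + k t\<^sup>2)\<close> of a conic.\<close>
definition conic_curve :: "real \<Rightarrow> 'a::real_vector \<Rightarrow> 'a \<Rightarrow> real \<Rightarrow> 'a" where
  "conic_curve k x v t = (2 * inverse (1 + k * t\<^sup>2) - 1) *\<^sub>R x + (t * inverse (1 + k * t\<^sup>2)) *\<^sub>R v"

lemma has_real_derivative_inverse_quadratic:
  fixes k t :: real
  assumes "1 + k * t\<^sup>2 \<noteq> 0"
  shows "((\<lambda>t. inverse (1 + k * t\<^sup>2)) has_real_derivative
    - 2 * k * t * (inverse (1 + k * t\<^sup>2))\<^sup>2) (at t)"
  using assms by (auto intro!: derivative_eq_intros simp: power2_eq_square)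

lemma vector_derivative_conic_curve: "vector_derivative (conic_curve k x v) (at 0) = v"
  unfolding conic_curve_def[abs_def]
  by (rule vector_derivative_at)
    (auto intro!: derivative_eq_intros has_real_derivative_inverse_quadratic)

lemma C2_curve_at_conic_curve:
  assumes "\<And>t. 1 + k * t\<^sup>2 \<noteq> 0 \<Longrightarrow> conic_curve k x v t \<in> M"
  shows "C2_curve_at M x (conic_curve k x v)"
proof -
  define U where "U = {t. 1 + k * t\<^sup>2 \<noteq> 0}"
  define h where "h t = inverse (1 + k * t\<^sup>2)" for t
  define h' where "h' t = - 2 * k * t * (h t)\<^sup>2" for t
  define h'' where "h'' t = - 2 * k * (h t)\<^sup>2 + 8 * k\<^sup>2 * t\<^sup>2 * h t ^ 3" for t
  have deriv_h: "(h has_real_derivative h' t) (at t)" if "t \<in> U" for t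
    using has_real_derivative_inverse_quadratic[of k t] that
    unfolding h_def[abs_def] h'_def U_def by simp
  have deriv_h': "(h' has_real_derivative h'' t) (at t)" if "t \<in> U" for t
    unfolding h'_def by (rule derivative_eq_intros deriv_h that refl)+
      (simp add: h''_def h'_def power2_eq_square power3_eq_cube algebra_simps)
  have "continuous_on U h"
    unfolding h_def U_def by (intro continuous_intros) auto
  define \<gamma>' where "\<gamma>' t = (2 * h' t) *\<^sub>R x + (h t + t * h' t) *\<^sub>R v" for t
  define \<gamma>'' where "\<gamma>'' t = (2 * h'' t) *\<^sub>R x + (2 * h' t + t * h'' t) *\<^sub>R v" for t
  show ?thesis
  proof (rule C2_curve_atI[of U _ _ _ \<gamma>' \<gamma>''])
    show "open U" unfolding U_def by (intro open_Collect_neq continuous_intros)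
    show "(conic_curve k x v has_vector_derivative \<gamma>' t) (at t)" if "t \<in> U" for t
      unfolding conic_curve_def[abs_def] h_def[symmetric] \<gamma>'_def
      by (rule derivative_eq_intros deriv_h that refl | simp add: mult.commute)+
    show "(\<gamma>' has_vector_derivative \<gamma>'' t) (at t)" if "t \<in> U" for t
      unfolding \<gamma>'_def \<gamma>''_def
      by (rule derivative_eq_intros deriv_h deriv_h' that refl | simp add: algebra_simps)+
    show "continuous_on U \<gamma>''"
      unfolding \<gamma>''_def h''_def h'_def by (intro continuous_intros \<open>continuous_on U h\<close>)
  qed (use assms in \<open>auto simp: U_def conic_curve_def[of k x v 0]\<close>)
qed

context quadratic_space
begin

definition level_set :: "'a \<Rightarrow> 'a set" where
  "level_set x = {y \<in> W. \<bar>B y y\<bar> = \<bar>B x x\<bar>}"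

lemma has_real_derivative_B:
  assumes "(f has_vector_derivative f') (at t)" "(g has_vector_derivative g') (at t)"
  shows "((\<lambda>t. B (f t) (g t)) has_real_derivative B (f t) g' + B f' (g t)) (at t)"
  using has_vector_derivative[OF assms] by (simp add: has_real_derivative_iff_has_vector_derivative)

lemma velocity_in_orth:
  assumes nonisotropic: "B x x \<noteq> 0" and "open U" "t \<in> U"
    and in_level_set: "\<And>s. s \<in> U \<Longrightarrow> \<gamma> s \<in> level_set x"
    and deriv: "(\<gamma> has_vector_derivative v) (at t)"
  shows "v \<in> orth (\<gamma> t)"
proof -
  have "((\<lambda>t. (B (\<gamma> t) (\<gamma> t))\<^sup>2) has_real_derivative
      2 * B (\<gamma> t) (\<gamma> t) * (B (\<gamma> t) v + B v (\<gamma> t))) (at t)"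
    by (rule derivative_eq_intros has_real_derivative_B[OF deriv deriv] refl | simp)+
  moreover have "(B (\<gamma> s) (\<gamma> s))\<^sup>2 = (B x x)\<^sup>2" if "s \<in> U" for s
    using in_level_set[OF that] by (simp add: level_set_def power2_eq_iff abs_eq_iff)
  ultimately have "2 * B (\<gamma> t) (\<gamma> t) * (B (\<gamma> t) v + B v (\<gamma> t)) = 0"
    by (intro has_real_derivative_locally_constant[OF assms(2,3)])
  moreover have "B (\<gamma> t) (\<gamma> t) \<noteq> 0"
    using in_level_set[OF assms(3)] nonisotropic by (auto simp: level_set_def)
  moreover have "v \<in> W"
    using has_vector_derivative_in_subspace[OF subspace_W assms(2,3) _ deriv] in_level_set
    by (simp add: level_set_def)
  ultimately show ?thesis using commute[of v "\<gamma> t"] by (simp add: orth_def)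
qed

context
  fixes x :: 'a
  assumes x_in_W: "x \<in> W" and nonisotropic: "B x x \<noteq> 0"
begin

lemma level_set_curve_derivatives:
  assumes "C2_curve_at (level_set x) x \<gamma>"
  shows "vector_derivative \<gamma> (at 0) \<in> orth x"
    and "deriv (B x \<circ> \<gamma>) 0 = 0"
    and "deriv (deriv (B x \<circ> \<gamma>)) 0 = - B (vector_derivative \<gamma> (at 0)) (vector_derivative \<gamma> (at 0))"
proof -
  obtain U \<gamma>' \<gamma>'' where U: "open U" "0 \<in> U" and start: "\<gamma> 0 = x"
    and in_level_set: "\<And>t. t \<in> U \<Longrightarrow> \<gamma> t \<in> level_set x"
    and deriv_\<gamma>: "\<And>t. t \<in> U \<Longrightarrow> (\<gamma> has_vector_derivative \<gamma>' t) (at t)"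
    and deriv_\<gamma>': "\<And>t. t \<in> U \<Longrightarrow> (\<gamma>' has_vector_derivative \<gamma>'' t) (at t)"
    using assms by (elim C2_curve_atE) blast
  have velocity: "\<gamma>' t \<in> orth (\<gamma> t)" if "t \<in> U" for t
    using velocity_in_orth[OF nonisotropic U(1) that in_level_set deriv_\<gamma>[OF that]] .
  have initial_velocity: "vector_derivative \<gamma> (at 0) = \<gamma>' 0"
    using deriv_\<gamma>[OF U(2)] by (rule vector_derivative_at)
  then show "vector_derivative \<gamma> (at 0) \<in> orth x" using velocity[OF U(2)] start by simp
  have first_deriv: "deriv (B x \<circ> \<gamma>) t = B x (\<gamma>' t)" if "t \<in> U" for t
    using has_real_derivative_B[OF has_vector_derivative_const deriv_\<gamma>[OF that], of x]
    by (intro DERIV_imp_deriv) (simp add: zero_left o_def)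
  show "deriv (B x \<circ> \<gamma>) 0 = 0"
    using first_deriv[OF U(2)] velocity[OF U(2)] start by (simp add: orth_def)
  have "B (\<gamma> 0) (\<gamma>'' 0) + B (\<gamma>' 0) (\<gamma>' 0) = 0"
    using velocity has_real_derivative_locally_constant[OF U _
        has_real_derivative_B[OF deriv_\<gamma> deriv_\<gamma>', OF U(2) U(2)]]
    by (auto simp: orth_def)
  moreover have "deriv (deriv (B x \<circ> \<gamma>)) 0 = deriv (\<lambda>t. B x (\<gamma>' t)) 0"
    using first_deriv U by (intro deriv_cong_ev) (auto simp: eventually_nhds)
  moreover have "deriv (\<lambda>t. B x (\<gamma>' t)) 0 = B x (\<gamma>'' 0)"
    using has_real_derivative_B[OF has_vector_derivative_const deriv_\<gamma>'[OF U(2)], of x]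
    by (intro DERIV_imp_deriv) (simp add: zero_left)
  ultimately show "deriv (deriv (B x \<circ> \<gamma>)) 0
      = - B (vector_derivative \<gamma> (at 0)) (vector_derivative \<gamma> (at 0))"
    unfolding initial_velocity start by simp
qed

lemma exists_level_set_curve:
  assumes "v \<in> orth x"
  shows "\<exists>\<gamma>. C2_curve_at (level_set x) x \<gamma> \<and> vector_derivative \<gamma> (at 0) = v"
proof -
  define k where "k = B v v / (4 * B x x)"
  then have B_v: "B v v = 4 * k * B x x" using nonisotropic by simp
  have "conic_curve k x v t \<in> level_set x" if "1 + k * t\<^sup>2 \<noteq> 0" for t
  proof -
    define h where "h = inverse (1 + k * t\<^sup>2)"
    then have h_inverse: "h * (1 + k * t\<^sup>2) = 1" using that by simp
    have "B (conic_curve k x v t) (conic_curve k x v t)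
        = (4 * h * (h * (1 + k * t\<^sup>2)) - 4 * h + 1) * B x x"
      unfolding conic_curve_def B_orth_add_scaleR[OF assms] B_v h_def[symmetric]
      by (simp add: power2_eq_square algebra_simps)
    also have "\<dots> = B x x" unfolding h_inverse by simp
    finally show ?thesis
      using x_in_W assms subspace_W
      by (auto simp: level_set_def conic_curve_def orth_def intro!: subspace_add subspace_scale)
  qed
  then show ?thesis using C2_curve_at_conic_curve vector_derivative_conic_curve by blast
qed

lemma tangent_space_level_set: "tangent_space (level_set x) x = orth x"
  using exists_level_set_curve level_set_curve_derivatives(1) unfolding tangent_space_def by blast

lemma hessian_form_level_set:
  assumes "v \<in> orth x"
  shows "hessian_form (B x) (level_set x) x v = - B v v"
proof -
  obtain \<gamma> where "C2_curve_at (level_set x) x \<gamma>" "vector_derivative \<gamma> (at 0) = v"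
    using exists_level_set_curve[OF assms] by blast
  then show ?thesis
    unfolding hessian_form_def using level_set_curve_derivatives(3) by (intro the_equality) metis+
qed

lemma nondeg_critical_point_level_set:
  assumes "nondegenerate"
  shows "nondeg_critical_point (B x) (level_set x) x"
  unfolding nondeg_critical_point_def critical_point_def tangent_space_level_set
proof (intro conjI ballI allI impI)
  fix u assume u: "u \<in> orth x"
    and annihilates: "\<forall>w\<in>orth x. hessian_form (B x) (level_set x) x (u + w)
      - hessian_form (B x) (level_set x) x u - hessian_form (B x) (level_set x) x w = 0"
  have "B u w = 0" if w: "w \<in> orth x" for w
  proof -
    have "- B (u + w) (u + w) + B u u + B w w = 0"
      using annihilates[rule_format, OF w] hessian_form_level_set[OF u] hessian_form_level_set[OF w]
        hessian_form_level_set[OF subspace_add[OF subspace_orth u w]] by linarith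
    then show ?thesis using commute[of w u] by (simp add: add_left add_right)
  qed
  then show "u = 0" using nondegenerate_on_orth[OF assms x_in_W nonisotropic u] by blast
qed (use x_in_W level_set_curve_derivatives(2) in \<open>auto simp: level_set_def\<close>)

theorem morse_index_level_set:
  "morse_index (B x) (level_set x) x + of_bool (0 < B x x) = pos_index B W"
proof -
  have "(subspace V \<and> V \<subseteq> orth x \<and> (\<forall>v\<in>V. v \<noteq> 0 \<longrightarrow> hessian_form (B x) (level_set x) x v < 0))
     \<longleftrightarrow> (subspace V \<and> V \<subseteq> orth x \<and> pos_def_on B V)" for V
    using hessian_form_level_set by (auto simp: subset_iff pos_def_on_def)
  then have "morse_index (B x) (level_set x) x = pos_index B (orth x)"
    unfolding morse_index_def tangent_space_level_set pos_index_def by simp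
  then show ?thesis using pos_index_orth[OF x_in_W nonisotropic] by simp
qed

end

end

section \<open>Intersections of lines and mixed areas\<close>

lemma cross_eq_Re_Im: "cross a b = Re a * Im b - Im a * Re b"
  by (simp add: cross_def)

lemma cross_commute: "cross b a = - cross a b"
  by (simp add: cross_eq_Re_Im)

interpretation cross: bounded_bilinear cross
proof -
  have "bilinear cross"
    by (auto simp: bilinear_def linear_iff cross_eq_Re_Im algebra_simps)
  then show "bounded_bilinear cross" by (simp add: bilinear_conv_bounded_bilinear)
qed

lemma cross_self [simp]: "cross a a = 0"
  by (simp add: cross_eq_Re_Im)

lemma cross_plucker: "cross b c *\<^sub>R a - cross a c *\<^sub>R b + cross a b *\<^sub>R c = 0"
  by (simp add: complex_eq_iff cross_eq_Re_Im algebra_simps)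

lemma cross_eq_0_imp_scaleR:
  assumes "cross a p = 0" "a \<noteq> 0"
  obtains l where "p = l *\<^sub>R a"
proof -
  have "(cmod a)\<^sup>2 *\<^sub>R p = (a \<bullet> p) *\<^sub>R a"
    using assms(1) unfolding cmod_power2
    by (simp add: complex_eq_iff cross_eq_Re_Im inner_complex_def) algebra
  moreover have "p = ((cmod a)\<^sup>2 *\<^sub>R p) /\<^sub>R (cmod a)\<^sup>2" using assms(2) by simp
  ultimately have "p = ((a \<bullet> p) / (cmod a)\<^sup>2) *\<^sub>R a"
    by (simp add: divide_inverse mult.commute)
  then show ?thesis by (rule that)
qed

lemma signed_length_eq_cross:
  assumes "cross a w = 0" "a \<noteq> 0" "cross a p = cmod a"
  shows "(if \<exists>t::real\<ge>0. w = of_real t * a then 1 else -1) * cmod w = cross w p"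
proof -
  obtain l where w_eq: "w = l *\<^sub>R a" using cross_eq_0_imp_scaleR assms(1,2) .
  have "(\<exists>t::real\<ge>0. w = of_real t * a) \<longleftrightarrow> l \<ge> 0"
    using assms(2) by (auto simp: w_eq scaleR_conv_of_real)
  then show ?thesis using assms(3) by (simp add: w_eq cross.scaleR_left)
qed

lemma infdist_line:
  assumes "a \<noteq> 0"
  shows "infdist X {p. cross a p = s} = \<bar>cross a X - s\<bar> / cmod a"
proof (rule antisym)
  define \<delta> where "\<delta> = cross a X - s"
  define foot where "foot = X - (\<delta> / (cmod a)\<^sup>2) *\<^sub>R (\<i> * a)"
  have "cross a (\<i> * a) = (cmod a)\<^sup>2"
    unfolding cmod_power2 by (simp add: cross_eq_Re_Im power2_eq_square)
  then have foot_on_line: "foot \<in> {p. cross a p = s}"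
    using assms by (simp add: foot_def \<delta>_def cross.diff_right cross.scaleR_right)
  have "dist X foot = \<bar>\<delta>\<bar> / cmod a"
    using assms by (simp add: foot_def dist_norm norm_mult power2_eq_square)
  then show "infdist X {p. cross a p = s} \<le> \<bar>cross a X - s\<bar> / cmod a"
    using infdist_le[OF foot_on_line, of X] by (simp add: \<delta>_def)
  have "\<bar>\<delta>\<bar> / cmod a \<le> dist X p" if "p \<in> {p. cross a p = s}" for p
  proof -
    have "\<delta> = cross a (X - p)" using that by (simp add: \<delta>_def cross.diff_right)
    also have "\<bar>\<dots>\<bar> \<le> cmod a * cmod (X - p)"
      unfolding cross_def using abs_Im_le_cmod[of "cnj a * (X - p)"] by (simp add: norm_mult)
    finally show ?thesis using assms by (simp add: dist_norm field_simps)
  qed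
  then show "\<bar>cross a X - s\<bar> / cmod a \<le> infdist X {p. cross a p = s}"
    using foot_on_line unfolding infdist_def \<delta>_def by (auto intro!: cINF_greatest)
qed

definition meet :: "complex \<Rightarrow> complex \<Rightarrow> real \<Rightarrow> real \<Rightarrow> complex" where
  "meet a b s t = (s *\<^sub>R b - t *\<^sub>R a) /\<^sub>R cross a b"

lemma cross_meet:
  assumes "cross a b \<noteq> 0"
  shows "cross a (meet a b s t) = s" "cross b (meet a b s t) = t"
proof -
  have "cross b a = - cross a b" by (rule cross_commute)
  then show "cross a (meet a b s t) = s" "cross b (meet a b s t) = t"
    using assms by (simp_all add: meet_def cross.scaleR_right cross.diff_right)
qed

lemma meet_eqI:
  assumes "cross a b \<noteq> 0" "cross a p = s" "cross b p = t"
  shows "meet a b s t = p"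
proof -
  have "s *\<^sub>R b - t *\<^sub>R a = cross a b *\<^sub>R p"
    unfolding assms(2,3)[symmetric] by (simp add: complex_eq_iff cross_eq_Re_Im algebra_simps)
  then show ?thesis using assms(1) by (simp add: meet_def)
qed

lemma meet_commute: "meet b a t s = meet a b s t"
  unfolding meet_def cross_commute[of b a] by (simp flip: scaleR_minus_right)

lemma meet_add: "meet a b (s + s') (t + t') = meet a b s t + meet a b s' t'"
  by (simp add: meet_def algebra_simps)

lemma meet_scaleR: "meet a b (k * s) (k * t) = k *\<^sub>R meet a b s t"
  by (simp add: meet_def algebra_simps)

text \<open>Cutting off the intersection of the lines \<open>a\<close> and \<open>c\<close> by the line \<open>b\<close>
  changes the mixed area by a product of the heights of the two cut-off triangles. Here
  \<open>p\<close>, \<open>q\<close>, \<open>u\<close> may be any points of the lines of the second polygon.\<close>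
lemma corner_mixed_area:
  assumes cross_nonzero: "cross a b \<noteq> 0" "cross b c \<noteq> 0" "cross a c \<noteq> 0"
    and on_lines: "cross a p = s'" "cross b q = t'" "cross c u = w'"
  shows "cross (meet a b s t) (q - p) + cross (meet b c t w) (u - q) + cross (meet c a w s) (p - u)
    = - cross a c / (cross a b * cross b c)
      * (t - cross b (meet a c s w)) * (t' - cross b (meet a c s' w'))"
proof -
  define m m' where "m = meet a c s w" and "m' = meet a c s' w'"
  define H H' where "H = t - cross b m" and "H' = t' - cross b m'"
  have cross_m: "cross a m = s" "cross c m = w" and cross_m': "cross a m' = s'" "cross c m' = w'"
    using cross_meet[OF cross_nonzero(3)] by (simp_all add: m_def m'_def)
  have meet_ab: "meet a b s t = m - (H / cross a b) *\<^sub>R a"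
    using cross_nonzero cross_m cross_commute[of a b]
    by (intro meet_eqI) (simp_all add: H_def cross.add_right cross.diff_right cross.scaleR_right)
  have meet_bc: "meet b c t w = m + (H / cross b c) *\<^sub>R c"
    using cross_nonzero cross_m
    by (intro meet_eqI) (simp_all add: H_def cross.add_right cross.scaleR_right)
  have plucker: "cross b c * cross a z - cross a c * cross b z + cross a b * cross c z = 0" for z
    using arg_cong[OF cross_plucker[of b c a], of "\<lambda>y. cross y z"]
    by (simp only: cross.add_left cross.diff_left cross.scaleR_left cross.zero_left real_scaleR_def)
  have "cross (meet a b s t) (q - p) + cross (meet b c t w) (u - q) + cross (meet c a w s) (p - u)
      = H / cross b c * (w' - cross c q) - H / cross a b * (cross a q - s')"
    unfolding meet_ab meet_bc meet_commute[of c a] m_def[symmetric] on_lines[symmetric]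
    by (simp add: cross.add_left cross.diff_left cross.diff_right cross.scaleR_left algebra_simps)
  also have "\<dots> = H * (cross b c * (s' - cross a q) + cross a b * (w' - cross c q))
      / (cross a b * cross b c)"
    using cross_nonzero by (simp add: field_simps)
  also have "cross b c * (s' - cross a q) + cross a b * (w' - cross c q) = - cross a c * H'"
    using plucker[of q] plucker[of m'] cross_m' on_lines(2) by (simp add: H'_def algebra_simps)
  finally show ?thesis by (simp add: H_def H'_def m_def m'_def mult_ac)
qed

lemma sum_cyclic_shift:
  fixes g :: "nat \<Rightarrow> 'a::comm_monoid_add"
  shows "(\<Sum>i<n. g (Suc i mod n)) = (\<Sum>i<n. g i)"
proof (cases n)
  case (Suc k)
  have "(\<Sum>i<n. g (Suc i mod n)) = (\<Sum>i<k. g (Suc i)) + g 0"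
    unfolding Suc by (simp add: lessThan_Suc add.commute)
  also have "\<dots> = (\<Sum>i<Suc k. g i)"
    by (simp add: sum.lessThan_Suc_shift add.commute del: sum.lessThan_Suc)
  finally show ?thesis by (simp add: Suc)
qed simp

lemma cyclic_sum_eq_fan_sum:
  fixes \<phi> :: "nat \<Rightarrow> nat \<Rightarrow> 'a::ab_group_add"
  assumes "2 \<le> n"
  shows "(\<Sum>i<n. \<phi> i (Suc i mod n)) =
     \<phi> 0 1 + \<phi> 1 0 + (\<Sum>m=2..<n. \<phi> (m - 1) m + \<phi> m 0 - \<phi> (m - 1) 0)"
proof -
  have "(\<Sum>i<k. \<phi> i (Suc i)) + \<phi> k 0 =
      \<phi> 0 1 + \<phi> 1 0 + (\<Sum>m=2..<Suc k. \<phi> (m - 1) m + \<phi> m 0 - \<phi> (m - 1) 0)" if "1 \<le> k" for k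
    using that
  proof (induction k rule: dec_induct)
    case base
    show ?case by (simp add: lessThan_Suc)
  next
    case (step k)
    then show ?case by (simp add: sum.atLeastLessThan_Suc algebra_simps)
  qed
  from this[of "n - 1"] show ?thesis using assms by (cases n) (simp_all add: lessThan_Suc add_ac)
qed

text \<open>The lines \<open>m - 1\<close>, \<open>m\<close> and \<open>0\<close> bound a triangle of oriented area
  \<open>fan_coef d m * (fan_height d m h)\<^sup>2\<close>.\<close>
definition fan_coef :: "(nat \<Rightarrow> complex) \<Rightarrow> nat \<Rightarrow> real" where
  "fan_coef d m = - cross (d (m - 1)) (d 0) / (2 * cross (d (m - 1)) (d m) * cross (d m) (d 0))"

definition fan_height :: "(nat \<Rightarrow> complex) \<Rightarrow> nat \<Rightarrow> (nat \<Rightarrow> real) \<Rightarrow> real" where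
  "fan_height d m h = h m - cross (d m) (meet (d (m - 1)) (d 0) (h (m - 1)) (h 0))"

lemma fan_height_add: "fan_height d m (\<lambda>i. h i + h' i) = fan_height d m h + fan_height d m h'"
  by (simp add: fan_height_def meet_add cross.add_right)

lemma fan_height_scale: "fan_height d m (\<lambda>i. k * h i) = k * fan_height d m h"
  by (simp add: fan_height_def meet_scaleR cross.scaleR_right algebra_simps)

definition mixed_area :: "nat \<Rightarrow> (nat \<Rightarrow> complex) \<Rightarrow> (nat \<Rightarrow> real) \<Rightarrow> (nat \<Rightarrow> real) \<Rightarrow> real" where
  "mixed_area n d h h' =
     (1/2) * (\<Sum>i<n. cross (vert n d h i) (vert n d h' (Suc i) - vert n d h' i))"

lemma area_eq_mixed_area: "area n d h = mixed_area n d h h"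
  by (simp add: area_def mixed_area_def cross_eq_Re_Im algebra_simps)

locale slopes =
  fixes n :: nat and d :: "nat \<Rightarrow> complex"
  assumes n_ge_2: "2 \<le> n"
    and not_parallel: "i < n \<Longrightarrow> j < n \<Longrightarrow> i \<noteq> j \<Longrightarrow> cross (d i) (d j) \<noteq> 0"
begin

lemma mod_less_n [simp]: "i mod n < n"
  using n_ge_2 by simp

lemma slope_nonzero: "i < n \<Longrightarrow> d i \<noteq> 0"
  using not_parallel[of i "if i = 0 then 1 else 0"] n_ge_2
  by (cases "i = 0") (auto simp: cross.zero_left)

lemma cross_Suc_nonzero: "cross (d (i mod n)) (d (Suc i mod n)) \<noteq> 0"
  using n_ge_2 by (intro not_parallel) (auto simp: mod_Suc intro: Suc_lessI)

lemma cross_fan_nonzero: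
  assumes "m \<in> {2..<n}"
  shows "cross (d (m - 1)) (d m) \<noteq> 0" "cross (d m) (d 0) \<noteq> 0" "cross (d (m - 1)) (d 0) \<noteq> 0"
  using assms by (intro not_parallel; auto)+

lemma fan_coef_nonzero: "m \<in> {2..<n} \<Longrightarrow> fan_coef d m \<noteq> 0"
  using cross_fan_nonzero[of m] by (simp add: fan_coef_def)

lemma vert_eq_meet:
  "vert n d h i = meet (d (i mod n)) (d (Suc i mod n)) (h (i mod n)) (h (Suc i mod n))"
  unfolding vert_def eline_def using cross_Suc_nonzero[of i]
  by (intro the_equality) (auto simp: cross_meet intro!: meet_eqI[symmetric])

lemma vert_mod: "vert n d h (i mod n) = vert n d h i"
  by (simp add: vert_eq_meet mod_Suc_eq)

lemma cross_vert:
  "cross (d (i mod n)) (vert n d h i) = h (i mod n)"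
  "cross (d (Suc i mod n)) (vert n d h i) = h (Suc i mod n)"
  unfolding vert_eq_meet using cross_meet[OF cross_Suc_nonzero] by auto

theorem mixed_area_eq_fan_sum:
  "mixed_area n d h h' = (\<Sum>m=2..<n. fan_coef d m * fan_height d m h * fan_height d m h')"
proof -
  define \<phi> where
    "\<phi> i j = cross (meet (d i) (d j) (h i) (h j)) (vert n d h' j - vert n d h' i)" for i j
  have antisym: "\<phi> i j = - \<phi> j i" for i j
    unfolding \<phi>_def meet_commute[of "d i"] by (simp add: cross.diff_right)
  have corner: "\<phi> (m - 1) m + \<phi> m 0 - \<phi> (m - 1) 0
      = 2 * (fan_coef d m * fan_height d m h * fan_height d m h')" if m: "m \<in> {2..<n}" for m
  proof -
    have "cross (d i) (vert n d h' i) = h' i" if "i < n" for i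
      using cross_vert(1)[of i h'] that by simp
    then have "\<phi> (m - 1) m + \<phi> m 0 + \<phi> 0 (m - 1)
        = 2 * (fan_coef d m * fan_height d m h * fan_height d m h')"
      unfolding \<phi>_def fan_coef_def fan_height_def
      using m by (subst corner_mixed_area[OF cross_fan_nonzero[OF m]]) auto
    then show ?thesis using antisym[of 0 "m - 1"] by simp
  qed
  have "2 * mixed_area n d h h' = (\<Sum>i<n. \<phi> i (Suc i mod n))"
    unfolding mixed_area_def by (simp add: \<phi>_def vert_eq_meet[of h] vert_mod)
  also have "\<dots> = \<phi> 0 1 + \<phi> 1 0 + (\<Sum>m=2..<n. \<phi> (m - 1) m + \<phi> m 0 - \<phi> (m - 1) 0)"
    by (rule cyclic_sum_eq_fan_sum[OF n_ge_2])
  also have "\<dots> = 2 * (\<Sum>m=2..<n. fan_coef d m * fan_height d m h * fan_height d m h')"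
    using antisym[of 0 1] corner by (simp add: sum_distrib_left)
  finally show ?thesis by simp
qed

lemma mixed_area_commute: "mixed_area n d h h' = mixed_area n d h' h"
  unfolding mixed_area_eq_fan_sum by (simp add: mult_ac)

lemma perim_eq_mixed_area: "perim n d h = - 2 * mixed_area n d h (\<lambda>i. cmod (d i))"
proof -
  let ?v = "vert n d h" and ?u = "vert n d (\<lambda>i. cmod (d i))"
  have "perim n d h = (\<Sum>i<n. cross (?v (Suc i) - ?v i) (?u (Suc i)))"
    unfolding perim_def
  proof (rule sum.cong[OF refl])
    fix i
    show "(if \<exists>t::real\<ge>0. ?v (Suc i) - ?v i = of_real t * d (Suc i mod n) then 1 else -1)
        * cmod (?v (Suc i) - ?v i) = cross (?v (Suc i) - ?v i) (?u (Suc i))"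
      using cross_vert(2)[of i h] cross_vert(1)[of "Suc i"]
      by (intro signed_length_eq_cross[of "d (Suc i mod n)"])
        (simp_all add: cross.diff_right slope_nonzero)
  qed
  also have "\<dots> = (\<Sum>i<n. cross (?v (Suc i mod n)) (?u (Suc i mod n)))
      - (\<Sum>i<n. cross (?v i) (?u (Suc i)))"
    by (simp add: cross.diff_left sum_subtractf vert_mod)
  also have "(\<Sum>i<n. cross (?v (Suc i mod n)) (?u (Suc i mod n))) = (\<Sum>i<n. cross (?v i) (?u i))"
    by (rule sum_cyclic_shift)
  finally show ?thesis by (simp add: mixed_area_def cross.diff_right sum_subtractf)
qed

lemma fan_height_translation:
  assumes "m \<in> {2..<n}"
  shows "fan_height d m (\<lambda>i. cross (d i) X) = 0"
  using meet_eqI[OF cross_fan_nonzero(3)[OF assms] refl refl] by (simp add: fan_height_def)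

end

section \<open>Turning angles and the winding number\<close>

definition turn_angle :: "complex \<Rightarrow> complex \<Rightarrow> real" where
  "turn_angle a b = Arg (b / a)"

lemma sgn_eq_cis_turn_angle: "a \<noteq> 0 \<Longrightarrow> b \<noteq> 0 \<Longrightarrow> sgn b = sgn a * cis (turn_angle a b)"
  by (simp add: turn_angle_def cis_Arg sgn_divide sgn_zero_iff)

lemma cross_eq_sin: "cross a b = cmod a * cmod b * sin (turn_angle a b)"
proof (cases "a = 0 \<or> b = 0")
  case False
  then have "sin (turn_angle a b) = Im (b / a) / cmod (b / a)"
    by (simp add: turn_angle_def sin_Arg)
  moreover have "Im (b / a) = cross a b / (cmod a)\<^sup>2"
    by (simp add: Im_divide cross_eq_Re_Im cmod_power2 mult.commute)
  ultimately show ?thesis using False by (simp add: norm_divide power2_eq_square)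
qed (auto simp: cross_def)

lemma turn_angle_bounds:
  assumes "cross a b \<noteq> 0"
  shows "- pi < turn_angle a b" "turn_angle a b < pi"
    "cross a b < 0 \<longleftrightarrow> turn_angle a b < 0" "turn_angle a b \<noteq> 0"
proof -
  have sin_turn: "sin (turn_angle a b) \<noteq> 0" "sin (turn_angle a b) < 0 \<longleftrightarrow> cross a b < 0"
    using assms by (auto simp: cross_eq_sin mult_less_0_iff)
  show bounds: "- pi < turn_angle a b" "turn_angle a b < pi"
    using sin_turn(1) mpi_less_Arg[of "b / a"] Arg_le_pi[of "b / a"]
    by (auto simp: turn_angle_def order_less_le)
  show "turn_angle a b \<noteq> 0" using sin_turn(1) by auto
  then show "cross a b < 0 \<longleftrightarrow> turn_angle a b < 0"
    using sin_turn(2) bounds sin_gt_zero[of "turn_angle a b"] sin_gt_zero[of "- turn_angle a b"]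
    by (cases "turn_angle a b < 0") auto
qed

text \<open>The counterclockwise angle, as a fraction of \<open>\<pi>\<close>, from the undirected line of \<open>a\<close> to
  that of \<open>b\<close>.\<close>
definition slope_angle :: "complex \<Rightarrow> complex \<Rightarrow> real" where
  "slope_angle a b = of_bool (cross a b < 0) + turn_angle a b / pi"

lemma slope_angle_bounds:
  assumes "cross a b \<noteq> 0"
  shows "0 < slope_angle a b" "slope_angle a b < 1"
  using turn_angle_bounds[OF assms] by (auto simp: slope_angle_def field_simps)

lemma slope_angle_commute:
  assumes "cross a b \<noteq> 0"
  shows "slope_angle a b + slope_angle b a = 1"
proof -
  have "b / a \<notin> \<real>"
    using turn_angle_bounds[OF assms] Arg_eq_0_pi[of "b / a"] by (auto simp: turn_angle_def)
  then have "turn_angle b a = - turn_angle a b"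
    using Arg_inverse[of "b / a"] by (simp add: turn_angle_def)
  then show ?thesis using assms cross_commute[of b a] by (auto simp: slope_angle_def)
qed

lemma turn_angle_add:
  assumes "a \<noteq> 0" "b \<noteq> 0" "c \<noteq> 0"
  obtains k :: int where "turn_angle a c = turn_angle a b + turn_angle b c + 2 * pi * k"
proof -
  have "c / a = (b / a) * (c / b)" using assms by simp
  then have "turn_angle a c - (turn_angle a b + turn_angle b c) \<in> {0, -2 * pi, 2 * pi}"
    using Arg_times'[of "b / a" "c / b"] assms by (auto simp: turn_angle_def)
  then show ?thesis using that[of 0] that[of "-1"] that[of 1] by auto
qed

lemma slope_angle_cocycle:
  assumes "cross a b \<noteq> 0" "cross b c \<noteq> 0" "cross a c \<noteq> 0"
  shows "slope_angle a b + slope_angle b c - slope_angle a c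
    = of_bool (0 < - cross a c / (2 * cross a b * cross b c))"
proof -
  have "a \<noteq> 0" "b \<noteq> 0" "c \<noteq> 0" using assms by (auto simp: cross.zero_left cross.zero_right)
  then obtain k :: int where
    turn_ac: "turn_angle a c = turn_angle a b + turn_angle b c + 2 * pi * k"
    using turn_angle_add by blast
  define N :: int where
    "N = of_bool (cross a b < 0) + of_bool (cross b c < 0) - of_bool (cross a c < 0) - 2 * k"
  have defect_eq: "slope_angle a b + slope_angle b c - slope_angle a c = of_int N"
    by (simp add: slope_angle_def N_def turn_ac add_divide_distrib)
  then have "- 1 < N" "N < 2"
    using slope_angle_bounds[OF assms(1)] slope_angle_bounds[OF assms(2)]
      slope_angle_bounds[OF assms(3)] by linarith+
  then have "N = of_bool (odd N)" by (cases "N = 0 \<or> N = 1") auto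
  also have "odd N \<longleftrightarrow> (cross a c < 0 \<longleftrightarrow> (cross a b < 0 \<longleftrightarrow> cross b c < 0))"
    by (auto simp: N_def)
  also have "\<dots> \<longleftrightarrow> 0 < - cross a c / (2 * cross a b * cross b c)"
    using assms
    by (auto simp: zero_less_divide_iff mult_less_0_iff zero_less_mult_iff divide_less_0_iff)
  finally show ?thesis unfolding defect_eq by simp
qed

lemma meet_unit_tangents:
  assumes "cross a b \<noteq> 0"
  defines "\<theta> \<equiv> turn_angle a b"
  shows "meet a b (cmod a) (cmod b) = \<i> * sgn a * cis (\<theta> / 2) /\<^sub>R cos (\<theta> / 2)"
    and "meet a b (cmod a) (cmod b) = \<i> * sgn b * cis (- \<theta> / 2) /\<^sub>R cos (\<theta> / 2)"
proof -
  have nonzero: "a \<noteq> 0" "b \<noteq> 0" using assms by (auto simp: cross.zero_left cross.zero_right)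
  have "cos (\<theta> / 2) > 0"
    using turn_angle_bounds[OF assms(1)] by (intro cos_gt_zero_pi) (auto simp: \<theta>_def)
  have sin_\<theta>: "sin \<theta> = 2 * sin (\<theta> / 2) * cos (\<theta> / 2)" using sin_double[of "\<theta> / 2"] by simp
  then have "sin (\<theta> / 2) \<noteq> 0" using assms(1) by (auto simp: cross_eq_sin \<theta>_def)
  have sgn_b: "sgn b = sgn a * cis \<theta>"
    using sgn_eq_cis_turn_angle[OF nonzero] by (simp add: \<theta>_def)
  have "cis \<theta> - 1 = cis (\<theta> / 2) * (cis (\<theta> / 2) - cis (- \<theta> / 2))"
    by (simp add: algebra_simps cis_mult)
  also have "cis (\<theta> / 2) - cis (- \<theta> / 2) = 2 * \<i> * sin (\<theta> / 2)"
    by (simp add: complex_eq_iff)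
  finally have chord: "sgn b - sgn a = 2 * \<i> * sin (\<theta> / 2) * sgn a * cis (\<theta> / 2)"
    unfolding sgn_b by (simp add: algebra_simps)
  have "sgn b - sgn a = (cmod a *\<^sub>R b - cmod b *\<^sub>R a) /\<^sub>R (cmod a * cmod b)"
    using nonzero by (simp add: sgn_div_norm scaleR_diff_right field_simps)
  then have "meet a b (cmod a) (cmod b) = (sgn b - sgn a) /\<^sub>R sin \<theta>"
    unfolding meet_def cross_eq_sin \<theta>_def[symmetric] by simp
  also have "\<dots> = \<i> * sgn a * cis (\<theta> / 2) /\<^sub>R cos (\<theta> / 2)"
    unfolding chord sin_\<theta> using \<open>sin (\<theta> / 2) \<noteq> 0\<close> \<open>cos (\<theta> / 2) > 0\<close>
    by (simp add: scaleR_conv_of_real field_simps)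
  finally show meet_eq: "meet a b (cmod a) (cmod b) = \<i> * sgn a * cis (\<theta> / 2) /\<^sub>R cos (\<theta> / 2)" .
  have "cis \<theta> * cis (- \<theta> / 2) = cis (\<theta> / 2)" by (simp add: cis_mult)
  then show "meet a b (cmod a) (cmod b) = \<i> * sgn b * cis (- \<theta> / 2) /\<^sub>R cos (\<theta> / 2)"
    unfolding meet_eq sgn_b by (simp add: mult.assoc)
qed

lemma Arg_meet_unit_tangents_ratio:
  assumes "cross a b \<noteq> 0" "cross b c \<noteq> 0"
  shows "Arg (meet b c (cmod b) (cmod c) / meet a b (cmod a) (cmod b))
    = (turn_angle a b + turn_angle b c) / 2"
proof -
  define \<theta> \<theta>' where "\<theta> = turn_angle a b" and "\<theta>' = turn_angle b c"
  have angles_bounded: "- pi < \<theta>" "\<theta> < pi" "- pi < \<theta>'" "\<theta>' < pi"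
    using turn_angle_bounds[OF assms(1)] turn_angle_bounds[OF assms(2)] by (auto simp: \<theta>_def \<theta>'_def)
  then have cos_pos: "cos (\<theta> / 2) > 0" "cos (\<theta>' / 2) > 0"
    by (auto intro!: cos_gt_zero_pi)
  have ratio: "(\<i> * u * w' /\<^sub>R k') / (\<i> * u * w /\<^sub>R k) = of_real (k / k') * (w' / w)"
    if "u \<noteq> 0" for u w w' :: complex and k k' :: real
    using that by (cases "w = 0 \<or> k = 0 \<or> k' = 0") (auto simp: scaleR_conv_of_real field_simps)
  have "sgn b \<noteq> 0" using assms(2) by (auto simp: sgn_zero_iff cross.zero_left)
  then have "meet b c (cmod b) (cmod c) / meet a b (cmod a) (cmod b)
      = of_real (cos (\<theta> / 2) / cos (\<theta>' / 2)) * (cis (\<theta>' / 2) / cis (- \<theta> / 2))"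
    unfolding meet_unit_tangents(1)[OF assms(2)] meet_unit_tangents(2)[OF assms(1)]
      \<theta>_def[symmetric] \<theta>'_def[symmetric] by (rule ratio)
  also have "\<dots> = rcis (cos (\<theta> / 2) / cos (\<theta>' / 2)) ((\<theta> + \<theta>') / 2)"
    by (simp add: rcis_def cis_divide add_divide_distrib add.commute)
  finally show ?thesis
    using angles_bounded cos_pos unfolding \<theta>_def[symmetric] \<theta>'_def[symmetric]
    by (intro Arg_unique'[of "cos (\<theta> / 2) / cos (\<theta>' / 2)"]) auto
qed

context slopes
begin

lemma is_incircle_iff:
  "is_incircle n d h X r \<longleftrightarrow> r \<noteq> 0 \<and> (\<forall>i<n. h i = cross (d i) X - r * cmod (d i))"
proof -
  have "infdist X (eline d h i) = \<bar>r\<bar> \<and> (0 < r \<longrightarrow> h i < cross (d i) X)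
        \<and> (r < 0 \<longrightarrow> cross (d i) X < h i)
      \<longleftrightarrow> h i = cross (d i) X - r * cmod (d i)" if "i < n" "r \<noteq> 0" for i
  proof -
    have "d i \<noteq> 0" using slope_nonzero that(1) .
    then have "infdist X (eline d h i) = \<bar>r\<bar> \<longleftrightarrow> \<bar>cross (d i) X - h i\<bar> = \<bar>r * cmod (d i)\<bar>"
      by (simp add: eline_def infdist_line divide_eq_eq abs_mult)
    moreover have "0 < r * cmod (d i) \<longleftrightarrow> 0 < r" "r * cmod (d i) < 0 \<longleftrightarrow> r < 0"
      using \<open>d i \<noteq> 0\<close> by (simp_all add: zero_less_mult_iff mult_less_0_iff)
    ultimately show ?thesis using \<open>r \<noteq> 0\<close> by (cases "0 < r") (auto simp: abs_if split: if_splits)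
  qed
  then show ?thesis unfolding is_incircle_def by blast
qed

definition total_turn :: real where
  "total_turn = (\<Sum>i<n. turn_angle (d i) (d (Suc i mod n)))"

lemma winding_poly_eq_total_turn:
  assumes "is_incircle n d h X r"
  shows "winding_poly n d h X = total_turn / (2 * pi)"
proof -
  let ?turn = "\<lambda>i. turn_angle (d (i mod n)) (d (Suc i mod n))"
  let ?unit = "\<lambda>i. meet (d (i mod n)) (d (Suc i mod n))
    (cmod (d (i mod n))) (cmod (d (Suc i mod n)))"
  have "r \<noteq> 0" and offset: "h (i mod n) = cross (d (i mod n)) X - r * cmod (d (i mod n))" for i
    using assms by (simp_all add: is_incircle_iff)
  have "vert n d h i - X = (- r) *\<^sub>R ?unit i" for i
    unfolding meet_scaleR[symmetric] using cross_vert[of i h] offset[of i] offset[of "Suc i"]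
    by (intro meet_eqI[symmetric] cross_Suc_nonzero) (simp_all add: cross.diff_right)
  then have "Arg ((vert n d h (Suc i) - X) / (vert n d h i - X))
      = (?turn i + ?turn (Suc i mod n)) / 2" for i
    using Arg_meet_unit_tangents_ratio[OF cross_Suc_nonzero cross_Suc_nonzero[of "Suc i"]] \<open>r \<noteq> 0\<close>
    by (simp add: scaleR_conv_of_real mod_Suc_eq)
  then have "winding_poly n d h X
      = ((\<Sum>i<n. ?turn i) + (\<Sum>i<n. ?turn (Suc i mod n))) / 2 / (2 * pi)"
    unfolding winding_poly_def by (simp only: sum.distrib flip: sum_divide_distrib)
  also have "(\<Sum>i<n. ?turn (Suc i mod n)) = (\<Sum>i<n. ?turn i)" by (rule sum_cyclic_shift)
  finally show ?thesis by (simp add: total_turn_def)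
qed

lemma RT_add_LT: "RT n d + LT n d = n"
proof -
  let ?R = "{i. i < n \<and> cross (d i) (d (Suc i mod n)) < 0}"
  let ?L = "{i. i < n \<and> cross (d i) (d (Suc i mod n)) > 0}"
  have "cross (d i) (d (Suc i mod n)) \<noteq> 0" if "i < n" for i
    using cross_Suc_nonzero[of i] that by simp
  then have "?R \<union> ?L = {..<n}" by (auto simp: linorder_neq_iff)
  moreover have "card (?R \<union> ?L) = card ?R + card ?L" by (intro card_Un_disjoint) auto
  ultimately show ?thesis by (simp add: RT_def LT_def)
qed

definition fan_count :: "real \<Rightarrow> nat" where
  "fan_count s = card {m \<in> {2..<n}. 0 < s * fan_coef d m}"

lemma fan_count_cong:
  assumes "sgn r = sgn s"
  shows "fan_count r = fan_count s"
proof -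
  have "0 < r * c \<longleftrightarrow> 0 < s * c" for c :: real
    using assms by (metis sgn_1_pos sgn_mult)
  then show ?thesis by (simp add: fan_count_def)
qed

lemma fan_count_add_minus:
  assumes "s \<noteq> 0"
  shows "fan_count s + fan_count (- s) = n - 2"
proof -
  let ?P = "\<lambda>s. {m \<in> {2..<n}. 0 < s * fan_coef d m}"
  have "0 < s * fan_coef d m \<or> 0 < - s * fan_coef d m" if "m \<in> {2..<n}" for m
  proof -
    have "s * fan_coef d m \<noteq> 0" using assms fan_coef_nonzero[OF that] by simp
    then show ?thesis by linarith
  qed
  then have "?P s \<union> ?P (- s) = {2..<n}" by blast
  moreover have "card (?P s \<union> ?P (- s)) = card (?P s) + card (?P (- s))"
    by (intro card_Un_disjoint) auto
  ultimately show ?thesis by (simp add: fan_count_def)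
qed

lemma fan_count_1: "real (fan_count 1) = real (RT n d) - 1 + total_turn / pi"
proof -
  let ?\<phi> = "\<lambda>i j. slope_angle (d i) (d j)"
  have "{i. i < n \<and> cross (d i) (d (Suc i mod n)) < 0}
      = {..<n} \<inter> {i. cross (d i) (d (Suc i mod n)) < 0}" by auto
  then have "real (RT n d) + total_turn / pi = (\<Sum>i<n. ?\<phi> i (Suc i mod n))"
    by (simp add: RT_def total_turn_def slope_angle_def sum.distrib sum_divide_distrib)
  also have "\<dots> = ?\<phi> 0 1 + ?\<phi> 1 0 + (\<Sum>m=2..<n. ?\<phi> (m - 1) m + ?\<phi> m 0 - ?\<phi> (m - 1) 0)"
    by (rule cyclic_sum_eq_fan_sum[OF n_ge_2])
  also have "?\<phi> 0 1 + ?\<phi> 1 0 = 1"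
    using n_ge_2 by (intro slope_angle_commute not_parallel) auto
  also have "(\<Sum>m=2..<n. ?\<phi> (m - 1) m + ?\<phi> m 0 - ?\<phi> (m - 1) 0)
      = (\<Sum>m=2..<n. of_bool (0 < fan_coef d m))"
    unfolding fan_coef_def by (intro sum.cong refl slope_angle_cocycle cross_fan_nonzero)
  also have "\<dots> = real (card ({2..<n} \<inter> {m. 0 < fan_coef d m}))" by simp
  also have "{2..<n} \<inter> {m. 0 < fan_coef d m} = {m \<in> {2..<n}. 0 < 1 * fan_coef d m}" by auto
  finally show ?thesis by (simp add: fan_count_def)
qed

theorem fan_count_eq_winding:
  assumes "is_incircle n d h X r"
  shows "real (fan_count r) = (if 0 < r then real (RT n d) - 1 + 2 * winding_poly n d h X
    else real (LT n d) - 1 - 2 * winding_poly n d h X)"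
proof -
  have fan_count_1_winding: "real (fan_count 1) = real (RT n d) - 1 + 2 * winding_poly n d h X"
    unfolding fan_count_1 winding_poly_eq_total_turn[OF assms] by simp
  show ?thesis
  proof (cases "0 < r")
    case True
    then show ?thesis using fan_count_1_winding fan_count_cong[of r 1] by simp
  next
    case False
    then have "fan_count r = fan_count (- 1)"
      using assms by (intro fan_count_cong) (auto simp: is_incircle_def)
    then show ?thesis
      using False fan_count_1_winding fan_count_add_minus[of 1] RT_add_LT n_ge_2 by simp
  qed
qed

end

section \<open>The space of polygons with given slopes\<close>

primrec offsets_of_heights :: "(nat \<Rightarrow> complex) \<Rightarrow> (nat \<Rightarrow> real) \<Rightarrow> nat \<Rightarrow> real" where
  "offsets_of_heights d c 0 = 0"
| "offsets_of_heights d c (Suc m) = (if m = 0 then 0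
     else c (Suc m) + cross (d (Suc m)) (meet (d m) (d 0) (offsets_of_heights d c m) 0))"

lemma fan_height_offsets_of_heights:
  assumes "2 \<le> m"
  shows "fan_height d m (offsets_of_heights d c) = c m"
proof -
  obtain k where "m = Suc k" "k \<noteq> 0" using assms by (cases m) auto
  then show ?thesis by (simp add: fan_height_def)
qed

locale polygon_space = slopes "CARD('n)" d for d :: "nat \<Rightarrow> complex" +
  fixes ix :: "nat \<Rightarrow> 'n::finite"
  assumes bij_ix: "bij_betw ix {..<CARD('n)} UNIV"
begin

definition pinned :: "(real^'n) set" where
  "pinned = {y. y $ ix 0 = 0 \<and> y $ ix 1 = 0}"

abbreviation height :: "nat \<Rightarrow> real^'n \<Rightarrow> real" where
  "height m y \<equiv> fan_height d m (offs ix y)"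

definition polar_area :: "real^'n \<Rightarrow> real^'n \<Rightarrow> real" where
  "polar_area y z = mixed_area CARD('n) d (offs ix y) (offs ix z)"

lemma offs_minus: "offs ix (- y) = (\<lambda>i. - offs ix y i)"
  by (auto simp: offs_def)

lemma subspace_pinned: "subspace pinned"
  by (auto simp: subspace_def pinned_def)

lemma linear_height: "linear (height m)"
proof (rule linearI)
  show "height m (y + z) = height m y + height m z" for y z
    using fan_height_add[of d m "offs ix y" "offs ix z"] by (simp add: offs_def[abs_def])
  show "height m (k *\<^sub>R y) = k *\<^sub>R height m y" for k y
    using fan_height_scale[of d m k "offs ix y"] by (simp add: offs_def[abs_def])
qed

lemma polar_area_eq:
  "polar_area y z = (\<Sum>m=2..<CARD('n). fan_coef d m * height m y * height m z)"
  by (simp add: polar_area_def mixed_area_eq_fan_sum)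

lemma polar_area_commute: "polar_area y z = polar_area z y"
  unfolding polar_area_def by (rule mixed_area_commute)

lemma bounded_bilinear_polar_area: "bounded_bilinear (\<lambda>y z. s * polar_area y z)"
proof -
  have "linear (polar_area y)" for y
    unfolding polar_area_eq[abs_def] linear_iff
    by (simp add: linear_add[OF linear_height] linear_cmul[OF linear_height]
        sum.distrib sum_distrib_left ring_distribs mult_ac)
  then have "linear (\<lambda>z. s * polar_area y z)" for y
    by (simp add: linear_iff ring_distribs mult_ac)
  then have "bilinear (\<lambda>y z. s * polar_area y z)"
    using polar_area_commute by (simp add: bilinear_def)
  then show ?thesis by (simp add: bilinear_conv_bounded_bilinear)
qed

lemma vec_eq_0_iff_ix: "y = 0 \<longleftrightarrow> (\<forall>i<CARD('n). y $ ix i = 0)" for y :: "real^'n"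
  using bij_ix unfolding vec_eq_iff bij_betw_def by (metis UNIV_I imageE lessThan_iff zero_index)

lemma eq_0_if_heights_0:
  assumes "y \<in> pinned" "\<And>m. m \<in> {2..<CARD('n)} \<Longrightarrow> height m y = 0"
  shows "y = 0"
proof -
  have "y $ ix i = 0" if "i < CARD('n)" for i
    using that
  proof (induction i)
    case (Suc m)
    show ?case
    proof (cases "m = 0")
      case False
      then have "height (Suc m) y = 0" using Suc.prems by (intro assms(2)) auto
      then show ?thesis
        using Suc assms(1)
        by (simp add: fan_height_def offs_def pinned_def meet_def cross.zero_right)
    qed (use assms(1) in \<open>simp add: pinned_def\<close>)
  qed (use assms(1) in \<open>simp add: pinned_def\<close>)
  then show ?thesis using vec_eq_0_iff_ix by blast
qed

lemma exists_pinned_with_heights: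
  "\<exists>y\<in>pinned. \<forall>m\<in>{2..<CARD('n)}. height m y = c m"
proof -
  define h where "h = offsets_of_heights d c"
  define y :: "real^'n" where "y = (\<chi> j. h (inv_into {..<CARD('n)} ix j))"
  have y_offset: "y $ ix i = h i" if "i < CARD('n)" for i
    using that bij_betw_inv_into_left[OF bij_ix, of i] by (simp add: y_def)
  have "height m y = c m" if "m \<in> {2..<CARD('n)}" for m
  proof -
    have "m < CARD('n)" "m - 1 < CARD('n)" "2 \<le> m" using that by auto
    then show ?thesis
      using y_offset fan_height_offsets_of_heights[of m d c]
      by (simp add: h_def fan_height_def offs_def)
  qed
  moreover have "y \<in> pinned" using y_offset n_ge_2 by (simp add: pinned_def h_def)
  ultimately show ?thesis by blast
qed

definition fan_basis :: "nat \<Rightarrow> real^'n" where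
  "fan_basis m = (SOME y. y \<in> pinned \<and> (\<forall>k\<in>{2..<CARD('n)}. height k y = of_bool (k = m)))"

lemma fan_basis: "fan_basis m \<in> pinned"
  and height_fan_basis: "k \<in> {2..<CARD('n)} \<Longrightarrow> height k (fan_basis m) = of_bool (k = m)"
  using someI_ex[of "\<lambda>y. y \<in> pinned \<and> (\<forall>k\<in>{2..<CARD('n)}. height k y = of_bool (k = m))"]
    exists_pinned_with_heights[of "\<lambda>k. of_bool (k = m)"]
  unfolding fan_basis_def by blast+

lemma span_fan_basis: "span (fan_basis ` {2..<CARD('n)}) = pinned"
proof
  show "span (fan_basis ` {2..<CARD('n)}) \<subseteq> pinned"
    using fan_basis subspace_pinned by (intro span_minimal) auto
  show "pinned \<subseteq> span (fan_basis ` {2..<CARD('n)})"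
  proof
    fix y assume "y \<in> pinned"
    define z where "z = (\<Sum>m=2..<CARD('n). height m y *\<^sub>R fan_basis m)"
    have "height k z = height k y" if "k \<in> {2..<CARD('n)}" for k
      using that by (simp add: z_def linear_sum[OF linear_height] linear_cmul[OF linear_height]
          height_fan_basis)
    then have "y - z = 0"
      using \<open>y \<in> pinned\<close> fan_basis subspace_pinned
      by (intro eq_0_if_heights_0) (auto simp: z_def linear_diff[OF linear_height]
          intro!: subspace_diff subspace_sum subspace_scale)
    moreover have "z \<in> span (fan_basis ` {2..<CARD('n)})"
      unfolding z_def by (intro span_sum span_scale span_base) auto
    ultimately show "y \<in> span (fan_basis ` {2..<CARD('n)})" by simp
  qed
qed

lemma polar_area_fan_basis:
  assumes "k \<in> {2..<CARD('n)}" "m \<in> {2..<CARD('n)}"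
  shows "polar_area (fan_basis k) (fan_basis m) = (if k = m then fan_coef d m else 0)"
proof -
  have "polar_area (fan_basis k) (fan_basis m)
      = (\<Sum>l=2..<CARD('n). if l = m then (if k = m then fan_coef d m else 0) else 0)"
    unfolding polar_area_eq by (intro sum.cong) (auto simp: height_fan_basis)
  then show ?thesis using assms(2) by simp
qed

lemma inj_fan_basis: "inj_on fan_basis {2..<CARD('n)}"
proof (rule inj_onI)
  fix k m assume "k \<in> {2..<CARD('n)}" "fan_basis k = fan_basis m"
  then have "of_bool (k = m) = (1 :: real)"
    using height_fan_basis[of k k] height_fan_basis[of k m] by simp
  then show "k = m" by simp
qed

lemma orthogonal_basis_fan:
  assumes "s \<noteq> 0"
  shows "orthogonal_basis (\<lambda>y z. s * polar_area y z) pinned (fan_basis ` {2..<CARD('n)})"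
proof (intro orthogonal_basis.intro quadratic_space.intro orthogonal_basis_axioms.intro
    quadratic_space_axioms.intro bounded_bilinear_polar_area subspace_pinned span_fan_basis)
  show "s * polar_area y z = s * polar_area z y" for y z
    using polar_area_commute by simp
qed (use assms in \<open>auto simp: polar_area_fan_basis fan_coef_nonzero\<close>)

lemma pos_index_polar_area:
  assumes "s \<noteq> 0"
  shows "pos_index (\<lambda>y z. s * polar_area y z) pinned = fan_count s"
proof -
  interpret orthogonal_basis "\<lambda>y z. s * polar_area y z" pinned "fan_basis ` {2..<CARD('n)}"
    using orthogonal_basis_fan[OF assms] .
  have "{u \<in> fan_basis ` {2..<CARD('n)}. 0 < s * polar_area u u}
      = fan_basis ` {m \<in> {2..<CARD('n)}. 0 < s * fan_coef d m}"
    by (auto simp: polar_area_fan_basis)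
  moreover have "inj_on fan_basis {m \<in> {2..<CARD('n)}. 0 < s * fan_coef d m}"
    by (rule inj_on_subset[OF inj_fan_basis]) auto
  ultimately show ?thesis unfolding pos_index_eq_card_pos fan_count_def by (simp only: card_image)
qed

lemma polyS_iff: "x \<in> polyS d ix \<longleftrightarrow> x \<in> pinned \<and> \<bar>polar_area x x\<bar> = 1"
  by (simp add: polyS_def pinned_def polar_area_def area_eq_mixed_area)

lemma perimF_minus: "perimF d ix (- x) = - perimF d ix x"
proof -
  have "fan_height d m (offs ix (- x)) = - height m x" for m
    using linear_neg[OF linear_height] .
  then show ?thesis by (simp add: perimF_def perim_eq_mixed_area mixed_area_eq_fan_sum sum_negf)
qed

lemma minus_in_polyS: "x \<in> polyS d ix \<Longrightarrow> - x \<in> polyS d ix"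
  by (simp add: polyS_iff pinned_def polar_area_eq linear_neg[OF linear_height])

lemma is_incircle_minus:
  "is_incircle CARD('n) d (offs ix x) X r \<Longrightarrow> is_incircle CARD('n) d (offs ix (- x)) (- X) (- r)"
  by (simp add: is_incircle_iff offs_minus cross.minus_right)

lemma height_if_incircle:
  assumes "is_incircle CARD('n) d (offs ix x) X r" and m: "m \<in> {2..<CARD('n)}"
  shows "height m x = - r * fan_height d m (\<lambda>i. cmod (d i))"
proof -
  have "m < CARD('n)" "m - 1 < CARD('n)" "0 < CARD('n)" using m by auto
  then have "height m x = fan_height d m (\<lambda>i. cross (d i) X + - r * cmod (d i))"
    using assms(1) by (simp add: is_incircle_iff fan_height_def)
  then show ?thesis
    by (simp only: fan_height_add fan_height_scale fan_height_translation[OF m] add_0)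
qed

lemma perimF_eq_polar_area:
  assumes "is_incircle CARD('n) d (offs ix x) X r"
  shows "perimF d ix y = 2 / r * polar_area x y"
proof -
  have "polar_area x y = - r * mixed_area CARD('n) d (offs ix y) (\<lambda>i. cmod (d i))"
    unfolding polar_area_eq mixed_area_eq_fan_sum sum_distrib_left
    by (intro sum.cong) (simp_all add: height_if_incircle[OF assms])
  moreover have "r \<noteq> 0" using assms by (simp add: is_incircle_def)
  ultimately show ?thesis by (simp add: perimF_def perim_eq_mixed_area)
qed

lemma perimF_nonzero:
  assumes "x \<in> polyS d ix" "is_incircle CARD('n) d (offs ix x) X r"
  shows "perimF d ix x \<noteq> 0"
proof -
  have "r \<noteq> 0" using assms(2) by (simp add: is_incircle_def)
  then show ?thesis using assms(1) by (auto simp: perimF_eq_polar_area[OF assms(2)] polyS_iff)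
qed

theorem
  assumes in_polyS: "x \<in> polyS d ix" and incircle: "is_incircle CARD('n) d (offs ix x) X r"
  shows nondeg_critical_point_perimF: "nondeg_critical_point (perimF d ix) (polyS d ix) x"
    and morse_index_perimF:
      "morse_index (perimF d ix) (polyS d ix) x + of_bool (0 < perimF d ix x) = fan_count r"
proof -
  define s where "s = 2 / r"
  have "s \<noteq> 0" using incircle by (simp add: s_def is_incircle_def)
  interpret orthogonal_basis "\<lambda>y z. s * polar_area y z" pinned "fan_basis ` {2..<CARD('n)}"
    using orthogonal_basis_fan[OF \<open>s \<noteq> 0\<close>] .
  have nonisotropic_x: "x \<in> pinned" "s * polar_area x x \<noteq> 0"
    using in_polyS \<open>s \<noteq> 0\<close> by (auto simp: polyS_iff)
  have polyS_eq: "polyS d ix = level_set x"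
    using in_polyS \<open>s \<noteq> 0\<close> by (auto simp: level_set_def polyS_iff abs_mult)
  have perimF_eq: "perimF d ix = (\<lambda>y. s * polar_area x y)"
    by (rule ext) (simp add: perimF_eq_polar_area[OF incircle] s_def)
  show "nondeg_critical_point (perimF d ix) (polyS d ix) x"
    unfolding polyS_eq perimF_eq
    using nondeg_critical_point_level_set[OF nonisotropic_x nondegenerate] .
  have "fan_count s = fan_count r" by (intro fan_count_cong) (simp add: s_def sgn_divide)
  then show "morse_index (perimF d ix) (polyS d ix) x + of_bool (0 < perimF d ix x) = fan_count r"
    using morse_index_level_set[OF nonisotropic_x] pos_index_polar_area[OF \<open>s \<noteq> 0\<close>]
    unfolding polyS_eq perimF_eq by simp
qed

end

theorem mainTheorem6:
  fixes d :: "nat \<Rightarrow> complex" and ix :: "nat \<Rightarrow> 'n::finite"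
    and x :: "real^'n" and X :: complex and r :: real
  assumes n3: "CARD('n) \<ge> 3"
    and ix: "bij_betw ix {..<CARD('n)} UNIV"
    and dnz: "\<forall>i<CARD('n). d i \<noteq> 0"
    and nonpar: "\<forall>i<CARD('n). \<forall>j<CARD('n). i \<noteq> j \<longrightarrow> cross (d i) (d j) \<noteq> 0"
    and QS: "x \<in> polyS d ix"
    and inc: "is_incircle CARD('n) d (offs ix x) X r"
  shows
    "(r > 0 \<longrightarrow>
        nondeg_critical_point (perimF d ix) (polyS d ix) x \<and>
        real (morse_index (perimF d ix) (polyS d ix) x) =
          real (RT CARD('n) d) - 1 + 2 * winding_poly CARD('n) d (offs ix x) X
          - (if perimF d ix x > 0 then 1 else 0)) \<and>
     (r < 0 \<longrightarrow>
        real (morse_index (perimF d ix) (polyS d ix) x) =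
          real CARD('n) - 3 - real (morse_index (perimF d ix) (polyS d ix) (- x)) \<and>
        real (morse_index (perimF d ix) (polyS d ix) x) =
          real (LT CARD('n) d) - 1 - 2 * winding_poly CARD('n) d (offs ix x) X
          - (if perimF d ix x > 0 then 1 else 0))"
proof -
  interpret polygon_space d ix
    by unfold_locales (use n3 ix nonpar in auto)
  note index = morse_index_perimF[OF QS inc]
  have index_minus:
    "morse_index (perimF d ix) (polyS d ix) (- x) + of_bool (perimF d ix x < 0) = fan_count (- r)"
    using morse_index_perimF[OF minus_in_polyS[OF QS] is_incircle_minus[OF inc]]
    by (simp add: perimF_minus)
  have "fan_count r + fan_count (- r) = CARD('n) - 2"
    using inc by (intro fan_count_add_minus) (simp add: is_incircle_def)
  then have "real (morse_index (perimF d ix) (polyS d ix) x)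
      = real CARD('n) - 3 - real (morse_index (perimF d ix) (polyS d ix) (- x))"
    using index index_minus perimF_nonzero[OF QS inc] n3 by (cases "0 < perimF d ix x") auto
  then show ?thesis
    using index fan_count_eq_winding[OF inc] nondeg_critical_point_perimF[OF QS inc] by auto
qed

end
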